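(* Let $m\ge2$ be even and let $a_1,\dots,a_m\ge2$ be integers. Let $\mathcal{O}=\min\{a_1,a_3,\dots,a_{m-1}\}$ and $\mathcal{E}=\min\{a_2,a_4,\dots,a_m\}$. Then \[R_{C_m}(a_1,a_2,\dots,a_m)=R_{C_m}(\mathcal{O},\mathcal{E},\mathcal{O},\mathcal{E},\dots,\mathcal{O},\mathcal{E}).\]
   Context: $C_m\le S_m$ denotes the cyclic group generated by the $m$-cycle $(1\,2\,\cdots\,m)$. An $m$-edge-coloured complete graph is a complete graph with each edge coloured from $[m]=\{1,\dots,m\}$. For $\Gamma\le S_m$, $\pi\in\Gamma$ and a vertex $v$, switching at $v$ with $\pi$ recolours every edge incident with $v$ of colour $i$ to colour $\pi(i)$, leaving other edges unchanged. Two such graphs on the same vertex set are $\Gamma$-switch equivalent if one is obtained from the other by a finite sequence of switches. $K_t^{(i)}$ is a complete graph on $t$ vertices with all edges of colour $i$. $R_\Gamma(a_1,\dots,a_m)$ is the least $n$ such that every $m$-edge-coloured complete graph on $n$ vertices is $\Gamma$-switch equivalent to one containing, for some $i$, a copy of $K_{a_i}^{(i)}$. *)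

theory Defs
  imports
    "HOL-Library.Ramsey"
    "HOL-Combinatorics.Cycles"
    "HOL-Algebra.Generated_Groups"
    "HOL-Algebra.Sym_Groups"
begin

text \<open>
  The edges of the complete graph on \<open>V\<close> are the two-element subsets of \<open>V\<close>, i.e. \<open>[V]\<^bsup>2\<^esup>\<close>.
  An edge-coloured complete graph on \<open>V\<close> is given by its colouring; colourings are extensional,
  so equal coloured graphs are equal functions.
\<close>

definition edge_colourings :: "nat \<Rightarrow> 'a set \<Rightarrow> ('a set \<Rightarrow> nat) set" where
  "edge_colourings m V = [V]\<^bsup>2\<^esup> \<rightarrow>\<^sub>E {1..m}"

definition switch :: "'a set \<Rightarrow> 'a \<Rightarrow> (nat \<Rightarrow> nat) \<Rightarrow> ('a set \<Rightarrow> nat) \<Rightarrow> 'a set \<Rightarrow> nat" where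
  "switch V v \<pi> c = (\<lambda>e. if e \<in> [V]\<^bsup>2\<^esup> \<and> v \<in> e then \<pi> (c e) else c e)"

definition switch_step ::
  "(nat \<Rightarrow> nat) set \<Rightarrow> 'a set \<Rightarrow> ('a set \<Rightarrow> nat) \<Rightarrow> ('a set \<Rightarrow> nat) \<Rightarrow> bool" where
  "switch_step \<Gamma> V c d \<longleftrightarrow> (\<exists>v\<in>V. \<exists>\<pi>\<in>\<Gamma>. d = switch V v \<pi> c)"

definition switch_equivalent ::
  "(nat \<Rightarrow> nat) set \<Rightarrow> 'a set \<Rightarrow> ('a set \<Rightarrow> nat) \<Rightarrow> ('a set \<Rightarrow> nat) \<Rightarrow> bool" where
  "switch_equivalent \<Gamma> V = (switch_step \<Gamma> V)\<^sup>*\<^sup>*"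

text \<open>
  A tuple \<open>(a\<^sub>1, \<dots>, a\<^sub>m)\<close> is a function \<open>a\<close>, of which only the values on \<open>{1..m}\<close> matter.
  Vertices are taken to be natural numbers, which covers all finite graphs up to isomorphism.
\<close>

definition switch_ramsey_prop ::
  "(nat \<Rightarrow> nat) set \<Rightarrow> nat \<Rightarrow> (nat \<Rightarrow> nat) \<Rightarrow> nat \<Rightarrow> bool" where
  "switch_ramsey_prop \<Gamma> m a n \<longleftrightarrow>
     (\<forall>V :: nat set. finite V \<and> card V = n \<longrightarrow>
       (\<forall>c\<in>edge_colourings m V.
         \<exists>d. switch_equivalent \<Gamma> V c d \<and> (\<exists>i\<in>{1..m}. monochromatic V (a i) 2 d i)))"

definition switch_ramsey :: "(nat \<Rightarrow> nat) set \<Rightarrow> nat \<Rightarrow> (nat \<Rightarrow> nat) \<Rightarrow> nat" where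
  "switch_ramsey \<Gamma> m a = (LEAST n. switch_ramsey_prop \<Gamma> m a n)"

definition cyclic_perms :: "nat \<Rightarrow> (nat \<Rightarrow> nat) set" where
  "cyclic_perms m = generate (sym_group m) {cycle_of_list [1..<Suc m]}"

text \<open>By Ramsey's theorem, the minimum defining \<^const>\<open>switch_ramsey\<close> is over a nonempty set.\<close>

lemma switch_ramsey_prop_exists:
  assumes "m \<ge> 1"
  shows "\<exists>n. switch_ramsey_prop \<Gamma> m a n"
proof -
  define \<alpha> where "\<alpha> = map a [1..<Suc m]"
  obtain N :: nat where N: "partn_lst {..<N} \<alpha> 2"
    using ramsey_full by blast
  have "switch_ramsey_prop \<Gamma> m a N"
    unfolding switch_ramsey_prop_def
  proof (intro allI impI ballI)
    fix V :: "nat set" and c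
    assume V: "finite V \<and> card V = N" and c: "c \<in> edge_colourings m V"
    obtain h where h: "bij_betw h {..<N} V"
      using V ex_bij_betw_nat_finite lessThan_atLeast0 by metis
    have hV: "h ` U \<in> [V]\<^bsup>k\<^esup>" if "U \<in> [{..<N}]\<^bsup>k\<^esup>" for U k
      using that h unfolding nsets_def bij_betw_def
      by (auto simp: card_image inj_on_subset)
    have range: "c (h ` U) \<in> {1..m}" if "U \<in> [{..<N}]\<^bsup>2\<^esup>" for U
      using hV[OF that] c unfolding edge_colourings_def by blast
    define f where "f = (\<lambda>U. c (h ` U) - 1)"
    have "f \<in> [{..<N}]\<^bsup>2\<^esup> \<rightarrow> {..<m}"
      using range unfolding f_def by fastforce
    then obtain i where i: "i < m" and "monochromatic {..<N} (\<alpha> ! i) 2 f i"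
      using partn_lstE[OF N, of f m] unfolding \<alpha>_def monochromatic_def
      by (metis length_map length_upt diff_Suc_1 image_subset_iff singleton_iff)
    moreover have "\<alpha> ! i = a (Suc i)"
      using i unfolding \<alpha>_def by (simp del: upt_Suc)
    ultimately obtain U where U: "U \<in> [{..<N}]\<^bsup>a (Suc i)\<^esup>" and fU: "f ` [U]\<^bsup>2\<^esup> \<subseteq> {i}"
      unfolding monochromatic_def by auto
    have "c ` [h ` U]\<^bsup>2\<^esup> \<subseteq> {Suc i}"
    proof clarify
      fix e assume "e \<in> [h ` U]\<^bsup>2\<^esup>"
      then obtain e' where e': "e' \<subseteq> U" "e = h ` e'" "card e = 2"
        unfolding nsets_def by (auto simp: subset_image_iff)
      have "e' \<subseteq> {..<N}"
        using U e'(1) unfolding nsets_def by auto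
      moreover from this have "card e' = 2"
        using e' h by (metis bij_betw_def card_image inj_on_subset)
      ultimately have "e' \<in> [U]\<^bsup>2\<^esup>" "e' \<in> [{..<N}]\<^bsup>2\<^esup>"
        using e'(1) by (auto simp: nsets_def intro: finite_subset)
      then have "c e - 1 = i" "c e \<in> {1..m}"
        using fU range e'(2) unfolding f_def by auto
      then show "c e = Suc i" by auto
    qed
    then have "monochromatic V (a (Suc i)) 2 c (Suc i)"
      using hV[OF U] unfolding monochromatic_def by blast
    moreover have "switch_equivalent \<Gamma> V c c"
      unfolding switch_equivalent_def by simp
    moreover have "Suc i \<in> {1..m}" using i by simp
    ultimately show "\<exists>d. switch_equivalent \<Gamma> V c d \<and> (\<exists>i\<in>{1..m}. monochromatic V (a i) 2 d i)"
      by blast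
  qed
  then show ?thesis ..
qed

end

theory Submission
  imports Defs
begin

text \<open>
  Switching once at every vertex with \<open>\<pi>\<close> applies \<open>\<pi>\<close> twice to every edge, once for each of its
  endpoints. With \<open>\<pi>\<close> a power of the \<open>m\<close>-cycle, a monochromatic clique of colour \<open>i\<close> can thus be
  moved to any colour of the same parity as \<open>i\<close>. Hence, for \<open>m\<close> even, the cheapest target within
  each parity class is all that matters, and the two Ramsey properties agree for every \<open>n\<close>.
\<close>

lemma monochromatic_mono:
  assumes "monochromatic V s r c i" and "t \<le> s"
  shows "monochromatic V t r c i"
proof -
  obtain H where H: "H \<in> [V]\<^bsup>s\<^esup>" "c ` [H]\<^bsup>r\<^esup> \<subseteq> {i}"
    using assms(1) unfolding monochromatic_def by blast
  then obtain K where "K \<subseteq> H" "card K = t" "finite K"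
    using assms(2) obtain_subset_with_card_n[of t H] unfolding nsets_def by auto
  then have "K \<in> [V]\<^bsup>t\<^esup>" "[K]\<^bsup>r\<^esup> \<subseteq> [H]\<^bsup>r\<^esup>"
    using H(1) by (auto simp: nsets_def)
  then show ?thesis
    using H(2) unfolding monochromatic_def by blast
qed

text \<open>Each edge takes one \<open>\<pi>\<close> per endpoint in \<open>W\<close>. Allowing any
  finite \<open>W\<close> inside \<open>V\<close>, and not just \<open>V\<close> itself, lets the
  vertices be switched one by one in an induction.\<close>

lemma switch_equivalent_switch_set:
  assumes "finite W" and "W \<subseteq> V" and "\<pi> \<in> \<Gamma>"
  shows "switch_equivalent \<Gamma> V c
           (\<lambda>e. if e \<in> [V]\<^bsup>2\<^esup> then (\<pi> ^^ card (e \<inter> W)) (c e) else c e)"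
  using assms(1,2)
proof (induction W rule: finite_induct)
  case empty
  have "(\<lambda>e. if e \<in> [V]\<^bsup>2\<^esup> then (\<pi> ^^ card (e \<inter> {})) (c e) else c e) = c"
    by (rule ext) simp
  then show ?case
    by (simp only: switch_equivalent_def rtranclp.rtrancl_refl)
next
  case (insert v W)
  let ?d = "\<lambda>W e. if e \<in> [V]\<^bsup>2\<^esup> then (\<pi> ^^ card (e \<inter> W)) (c e) else c e"
  \<comment> \<open>Since \<open>v\<close> is not in \<open>W\<close>, the exponent grows by one
    exactly on the edges through \<open>v\<close>, which are those that the switch at
    \<open>v\<close> recolours.\<close>
  have "?d (insert v W) = switch V v \<pi> (?d W)"
    using insert.hyps by (auto simp: switch_def fun_eq_iff)
  then have "switch_step \<Gamma> V (?d W) (?d (insert v W))"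
    using insert.prems assms(3) unfolding switch_step_def by blast
  moreover have "switch_equivalent \<Gamma> V c (?d W)"
    using insert by blast
  ultimately show ?case
    unfolding switch_equivalent_def by (rule rtranclp.rtrancl_into_rtrancl[rotated])
qed

lemma monochromatic_switch_all:
  assumes "finite V" and "\<pi> \<in> \<Gamma>" and "monochromatic V s 2 c i"
  obtains d where "switch_equivalent \<Gamma> V c d" and "monochromatic V s 2 d (\<pi> (\<pi> i))"
proof
  let ?d = "\<lambda>e. if e \<in> [V]\<^bsup>2\<^esup> then (\<pi> ^^ card (e \<inter> V)) (c e) else c e"
  show "switch_equivalent \<Gamma> V c ?d"
    using assms(1,2) by (intro switch_equivalent_switch_set) auto
  obtain H where H: "H \<in> [V]\<^bsup>s\<^esup>" "c ` [H]\<^bsup>2\<^esup> \<subseteq> {i}"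
    using assms(3) unfolding monochromatic_def by blast
  have "?d e = \<pi> (\<pi> i)" if e: "e \<in> [H]\<^bsup>2\<^esup>" for e
  proof -
    have "e \<in> [V]\<^bsup>2\<^esup>" "e \<inter> V = e" "card e = 2"
      using e H(1) by (auto simp: nsets_def)
    moreover have "c e = i"
      using e H(2) by blast
    ultimately show ?thesis
      by (simp add: numeral_2_eq_2)
  qed
  then have "?d ` [H]\<^bsup>2\<^esup> \<subseteq> {\<pi> (\<pi> i)}"
    by blast
  then show "monochromatic V s 2 ?d (\<pi> (\<pi> i))"
    using H(1) unfolding monochromatic_def by blast
qed

lemma funpow_cycle_in_cyclic_perms:
  "cycle_of_list [1..<Suc m] ^^ k \<in> cyclic_perms m"
proof (induction k)
  case 0
  then show ?case
    using generate.one[of "sym_group m"] by (simp add: cyclic_perms_def sym_group_def id_def)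
next
  case (Suc k)
  let ?\<sigma> = "cycle_of_list [1..<Suc m]"
  have "?\<sigma> \<otimes>\<^bsub>sym_group m\<^esub> (?\<sigma> ^^ k) \<in> cyclic_perms m"
    using Suc unfolding cyclic_perms_def by (rule generate.eng[OF generate.incl[OF singletonI]])
  then show ?case
    by (simp only: sym_group_mult funpow.simps)
qed

text \<open>Applying the \<open>n\<close>-th power of a cycle to its own list rotates that list by
  \<open>n\<close> places. Colours start at 1 and list positions at 0, so colour \<open>i\<close>
  sits at position \<open>i - 1\<close>.\<close>

lemma funpow_cycle_of_list_upt:
  assumes "i \<in> {1..m}"
  shows "(cycle_of_list [1..<Suc m] ^^ n) i = (n + (i - 1)) mod m + 1"
proof -
  let ?cs = "[1..<Suc m]"
  have "(cycle_of_list ?cs ^^ n) (?cs ! (i - 1)) = map (cycle_of_list ?cs ^^ n) ?cs ! (i - 1)"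
    using assms by (subst nth_map) (auto simp del: upt_Suc)
  also have "\<dots> = rotate n ?cs ! (i - 1)"
    by (subst cyclic_rotation) (auto simp del: upt_Suc)
  also have "\<dots> = ?cs ! ((n + (i - 1)) mod m)"
    using assms by (subst nth_rotate) (auto simp: add.commute simp del: upt_Suc)
  also have "\<dots> = (n + (i - 1)) mod m + 1"
    using assms by (subst nth_upt) auto
  also have "?cs ! (i - 1) = i"
    using assms by (subst nth_upt) auto
  finally show ?thesis .
qed

lemma monochromatic_change_colour:
  assumes "even m" and "finite V" and "i \<in> {1..m}" and "j \<in> {1..m}" and "even i \<longleftrightarrow> even j"
    and "monochromatic V s 2 c i"
  obtains d where "switch_equivalent (cyclic_perms m) V c d" and "monochromatic V s 2 d j"
proof -
  \<comment> \<open>Two applications of \<open>\<pi>\<close> shift colours by \<open>2 * k\<close>,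
    which must be \<open>j - i\<close> modulo \<open>m\<close>. The added \<open>m\<close> keeps the
    subtraction from truncating, and as \<open>m\<close> is even it preserves the parity that makes
    the halving exact.\<close>
  define k where "k = (m + j - i) div 2"
  define \<pi> where "\<pi> = cycle_of_list [1..<Suc m] ^^ k"
  have "even (m + j - i)"
    using assms(1,3,5) by auto
  then have k: "k + k = m + j - i"
    unfolding k_def by presburger
  have "\<pi> (\<pi> i) = (cycle_of_list [1..<Suc m] ^^ (k + k)) i"
    by (simp add: \<pi>_def funpow_add del: upt_Suc)
  also have "\<dots> = (m + j - i + (i - 1)) mod m + 1"
    unfolding k by (rule funpow_cycle_of_list_upt[OF assms(3)])
  also have "m + j - i + (i - 1) = (j - 1) + m"
    using assms(3,4) by auto
  also have "((j - 1) + m) mod m + 1 = j"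
    unfolding mod_add_self2 using assms(4) by (subst mod_less) auto
  finally have "\<pi> (\<pi> i) = j" .
  moreover have "\<pi> \<in> cyclic_perms m"
    unfolding \<pi>_def by (rule funpow_cycle_in_cyclic_perms)
  ultimately show thesis
    using monochromatic_switch_all[OF assms(2) _ assms(6), of \<pi>] that by auto
qed

text \<open>The equivalence already holds colouring by colouring. From \<open>a\<close> to
  \<open>b\<close> one shrinks the clique; from \<open>b\<close> to \<open>a\<close> one moves a
  clique of size \<open>b i\<close> to a colour \<open>j\<close> of the same parity with
  \<open>a j = b i\<close>.\<close>

lemma switch_ramsey_prop_parity:
  assumes "even m"
    and le: "\<And>i. i \<in> {1..m} \<Longrightarrow> b i \<le> a i"
    and attained: "\<And>i. i \<in> {1..m} \<Longrightarrow> \<exists>j\<in>{1..m}. (even i \<longleftrightarrow> even j) \<and> a j = b i"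
  shows "switch_ramsey_prop (cyclic_perms m) m a n \<longleftrightarrow> switch_ramsey_prop (cyclic_perms m) m b n"
proof -
  have *: "(\<exists>d. switch_equivalent (cyclic_perms m) V c d \<and> (\<exists>i\<in>{1..m}. monochromatic V (a i) 2 d i))
    \<longleftrightarrow> (\<exists>d. switch_equivalent (cyclic_perms m) V c d \<and> (\<exists>i\<in>{1..m}. monochromatic V (b i) 2 d i))"
    (is "?A \<longleftrightarrow> ?B") if fin: "finite V" for V :: "nat set" and c
  proof
    assume ?A
    then show ?B
      by (meson monochromatic_mono le)
  next
    assume ?B
    then obtain d i where d: "switch_equivalent (cyclic_perms m) V c d"
      and i: "i \<in> {1..m}" "monochromatic V (b i) 2 d i"
      by blast
    obtain j where j: "j \<in> {1..m}" "even i \<longleftrightarrow> even j" "a j = b i"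
      using attained[OF i(1)] by blast
    obtain d' where d': "switch_equivalent (cyclic_perms m) V d d'"
      and "monochromatic V (b i) 2 d' j"
      by (rule monochromatic_change_colour[OF assms(1) fin i(1) j(1,2) i(2)])
    then have "monochromatic V (a j) 2 d' j"
      using j(3) by simp
    moreover have "switch_equivalent (cyclic_perms m) V c d'"
      using d d' unfolding switch_equivalent_def by (rule rtranclp_trans)
    ultimately show ?A
      using j(1) by blast
  qed
  \<comment> \<open>The final \<open>conjunct1\<close> extracts the premise \<open>finite V\<close>
    of \<open>*\<close> from the guard \<open>finite V \<and> card V = n\<close>.\<close>
  show ?thesis
    unfolding switch_ramsey_prop_def by (intro all_cong ball_cong refl *) (rule conjunct1)
qed

theorem theorem19:
  fixes m :: nat and a :: "nat \<Rightarrow> nat" and Od Ev :: nat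
  assumes "m \<ge> 2" and "even m"
    and "\<forall>i\<in>{1..m}. a i \<ge> 2"
    and "Od = Min (a ` {i \<in> {1..m}. odd i})"
    and "Ev = Min (a ` {i \<in> {1..m}. even i})"
  shows "switch_ramsey (cyclic_perms m) m a
       = switch_ramsey (cyclic_perms m) m (\<lambda>i. if odd i then Od else Ev)"
proof -
  let ?b = "\<lambda>i. if odd i then Od else Ev"
  have "?b i \<le> a i" if "i \<in> {1..m}" for i
    using that unfolding assms(4,5) by (auto intro!: Min_le)
  moreover have "\<exists>j\<in>{1..m}. (even i \<longleftrightarrow> even j) \<and> a j = ?b i" if "i \<in> {1..m}" for i
  proof (cases "odd i")
    case True
    then have "Od \<in> a ` {i \<in> {1..m}. odd i}"
      \<comment> \<open>\<open>Min_in\<close> needs a nonempty set, and \<open>i\<close> itself is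
        an odd index.\<close>
      using that unfolding assms(4) by (intro Min_in) auto
    then show ?thesis
      using True by auto
  next
    case False
    then have "Ev \<in> a ` {i \<in> {1..m}. even i}"
      using that unfolding assms(5) by (intro Min_in) auto
    then show ?thesis
      using False by auto
  qed
  \<comment> \<open>Equality of the predicates at every \<open>n\<close> makes their
    \<open>LEAST\<close> values equal, whether or not these are known.\<close>
  ultimately have "switch_ramsey_prop (cyclic_perms m) m a = switch_ramsey_prop (cyclic_perms m) m ?b"
    by (intro ext switch_ramsey_prop_parity[OF assms(2)])
  then show ?thesis
    unfolding switch_ramsey_def by (rule arg_cong)
qed

end
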